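(* In the payment network creation game with $n=4$ players, betweenness weight $b\ge 0$ and closeness weight $c>0$, the circle graph (the cycle $C_4$ on all players) is a Nash equilibrium if and only if $c\le 1\le b+2c$.
   Context: Payment network creation game. There are $n$ players $[n]=\{0,1,\dots,n-1\}$. A strategy of player $u$ is a set $s_u\subseteq [n]\setminus\{u\}$ (the players to whom $u$ opens a channel). A strategy combination is $s=(s_0,\dots,s_{n-1})$, and $G[s]$ is the undirected simple graph on $[n]$ in which $u,v$ are adjacent iff $v\in s_u$ or $u\in s_v$. With weights $b\ge 0$ and $c>0$, the cost of $u$ is $$\mathrm{cost}_u(s)=|s_u|+b\cdot \mathrm{betweenness}_u(s)+c\cdot \mathrm{closeness}_u(s),$$ $$\mathrm{betweenness}_u(s)=(n-1)(n-2)-\sum_{\substack{(i,j)\in[n]^2:\ i\ne j,\ i\neq u,\ j\ne u,\\ m(i,j)>0}}\frac{m_u(i,j)}{m(i,j)},\qquad \mathrm{closeness}_u(s)=\sum_{v\in[n]\setminus\{u\}}\bigl(d_{G[s]}(u,v)-1\bigr).$$ The sum in the betweenness runs over ordered pairs; $m(i,j)$ is the number of shortest paths between $i$ and $j$ in $G[s]$ and $m_u(i,j)$ the number of those passing through $u$; $d_{G[s]}$ is graph distance, equal to $\infty$ between different components. A strategy combination $s$ is a Nash equilibrium if no player can strictly decrease her cost by unilaterally changing her strategy; a graph $G$ is called a Nash equilibrium if $G=G[s]$ for some strategy combination $s$ that is a Nash equilibrium. *)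

theory Defs
  imports
    "Graph_Theory.Digraph"
    "Graph_Theory.Arc_Walk"
    "Graph_Theory.Pair_Digraph"
    "Graph_Theory.Shortest_Path"
begin

text \<open>Only the values of a strategy combination at the players \<open>0, \<dots>, n - 1\<close> are relevant.\<close>

definition strategy_combination :: "nat \<Rightarrow> (nat \<Rightarrow> nat set) \<Rightarrow> bool" where
  "strategy_combination n s \<longleftrightarrow> (\<forall>u<n. s u \<subseteq> {..<n} - {u})"

text \<open>As usual in \<^theory>\<open>Graph_Theory.Digraph\<close>, an undirected simple graph is a symmetric
  loop-free digraph without parallel arcs (\<^const>\<open>pair_graph\<close>).\<close>

definition strategy_graph :: "nat \<Rightarrow> (nat \<Rightarrow> nat set) \<Rightarrow> nat pair_pre_digraph" where
  "strategy_graph n s =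
     \<lparr> pverts = {..<n},
       parcs = {(u, v). u < n \<and> v < n \<and> (v \<in> s u \<or> u \<in> s v)} \<rparr>"

lemma pair_graph_strategy_graph:
  assumes "strategy_combination n s"
  shows "pair_graph (strategy_graph n s)"
proof
  show "finite (parcs (strategy_graph n s))"
    by (rule finite_subset[of _ "{..<n} \<times> {..<n}"]) (auto simp: strategy_graph_def)
qed (use assms in \<open>(fastforce simp: strategy_graph_def strategy_combination_def symmetric_def sym_def)+\<close>)

definition graph_dist :: "'a pair_pre_digraph \<Rightarrow> 'a \<Rightarrow> 'a \<Rightarrow> ereal" where
  "graph_dist G = wf_digraph.\<mu> (with_proj G) (\<lambda>_. 1)"

definition shortest_paths :: "'a pair_pre_digraph \<Rightarrow> 'a \<Rightarrow> 'a \<Rightarrow> ('a \<times> 'a) list set" where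
  "shortest_paths G i j =
     {p. pre_digraph.apath (with_proj G) i p j \<and> ereal (real (length p)) = graph_dist G i j}"

definition num_shortest_paths :: "'a pair_pre_digraph \<Rightarrow> 'a \<Rightarrow> 'a \<Rightarrow> nat" where
  "num_shortest_paths G i j = card (shortest_paths G i j)"

definition num_shortest_paths_through ::
    "'a pair_pre_digraph \<Rightarrow> 'a \<Rightarrow> 'a \<Rightarrow> 'a \<Rightarrow> nat" where
  "num_shortest_paths_through G u i j =
     card {p \<in> shortest_paths G i j. u \<in> set (pre_digraph.awalk_verts (with_proj G) i p)}"

definition betweenness :: "nat \<Rightarrow> (nat \<Rightarrow> nat set) \<Rightarrow> nat \<Rightarrow> real" where
  "betweenness n s u =
     (real n - 1) * (real n - 2) -
     (\<Sum>(i, j) \<in> {(i, j). i < n \<and> j < n \<and> i \<noteq> j \<and> i \<noteq> u \<and> j \<noteq> u \<and>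
                         num_shortest_paths (strategy_graph n s) i j > 0}.
        real (num_shortest_paths_through (strategy_graph n s) u i j) /
        real (num_shortest_paths (strategy_graph n s) i j))"

definition closeness :: "nat \<Rightarrow> (nat \<Rightarrow> nat set) \<Rightarrow> nat \<Rightarrow> ereal" where
  "closeness n s u = (\<Sum>v \<in> {..<n} - {u}. graph_dist (strategy_graph n s) u v - 1)"

definition cost :: "nat \<Rightarrow> real \<Rightarrow> real \<Rightarrow> (nat \<Rightarrow> nat set) \<Rightarrow> nat \<Rightarrow> ereal" where
  "cost n b c s u =
     ereal (real (card (s u))) + ereal b * ereal (betweenness n s u) + ereal c * closeness n s u"

definition nash_equilibrium :: "nat \<Rightarrow> real \<Rightarrow> real \<Rightarrow> (nat \<Rightarrow> nat set) \<Rightarrow> bool" where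
  "nash_equilibrium n b c s \<longleftrightarrow>
     strategy_combination n s \<and>
     (\<forall>u<n. \<forall>t. t \<subseteq> {..<n} - {u} \<longrightarrow> \<not> cost n b c (s(u := t)) u < cost n b c s u)"

definition nash_equilibrium_graph :: "nat \<Rightarrow> real \<Rightarrow> real \<Rightarrow> nat pair_pre_digraph \<Rightarrow> bool" where
  "nash_equilibrium_graph n b c G \<longleftrightarrow> (\<exists>s. nash_equilibrium n b c s \<and> G = strategy_graph n s)"

text \<open>A cycle through all players, in the order \<open>p 0, \<dots>, p (n - 1)\<close>; meaningful for \<open>n \<ge> 3\<close>.\<close>

definition circle_graph :: "nat \<Rightarrow> nat pair_pre_digraph \<Rightarrow> bool" where
  "circle_graph n G \<longleftrightarrow>
     (\<exists>p. bij_betw p {..<n} {..<n} \<and>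
        G = \<lparr> pverts = {..<n},
              parcs = (\<Union>i<n. {(p i, p (Suc i mod n)), (p (Suc i mod n), p i)}) \<rparr>)"

end

theory Submission
  imports Defs
begin

text \<open>Removing player \<open>u\<close> from the cycle \<open>u, v, w, x\<close> leaves the path \<open>v, w, x\<close>, so a deviation of
  \<open>u\<close> only selects the neighbourhood of \<open>u\<close> on this path. Besides the number of channels, \<open>u\<close> pays
  \<open>5 b + c\<close> on the cycle, \<open>6 b + 3 c\<close> when attached to a single end of the path, and \<open>5 b\<close> when
  attached to all of it. Opening the diagonal forces \<open>c \<le> 1\<close> and dropping one cycle channel forces
  \<open>1 \<le> b + 2 c\<close>. Conversely, orient the cycle so that every player owns exactly one channel: then
  \<open>u\<close> can never cut herself off, and no selection of a neighbourhood is an improvement.\<close>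

section \<open>Distances up to three and shortest paths of length at most two\<close>

context pair_wf_digraph
begin

text \<open>\<open>graph_dist\<close> is an infimum over walks, and unit weights make the cost of a
  walk its length, so a walk of minimal length attains it.\<close>

lemma graph_dist_eqI:
  assumes "awalk u p v" and "\<And>q. awalk u q v \<Longrightarrow> length p \<le> length q"
  shows "graph_dist G u v = ereal (real (length p))"
proof -
  have cost: "awalk_cost (\<lambda>_. 1) q = real (length q)" for q
    by (induct q) auto
  show ?thesis
    unfolding graph_dist_def \<mu>_def cost using assms
    by (intro INF_eqI) auto
qed

lemma awalk_2_le_length:
  assumes "awalk u p v" "u \<noteq> v" "(u, v) \<notin> parcs G"
  shows "2 \<le> length p"
proof (rule ccontr)
  assume "\<not> 2 \<le> length p"
  then consider "p = []" | e where "p = [e]"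
    by (cases p; cases "tl p") auto
  then show False
    using assms by cases (auto simp: awalk_simps)
qed

lemma awalk_3_le_length:
  assumes "awalk u p v" "u \<noteq> v" "(u, v) \<notin> parcs G"
    and "\<And>w. (u, w) \<in> parcs G \<Longrightarrow> (w, v) \<notin> parcs G"
  shows "3 \<le> length p"
proof (rule ccontr)
  assume "\<not> 3 \<le> length p"
  with awalk_2_le_length[OF assms(1-3)] have "length p = 2"
    by simp
  then obtain e f where "p = [e, f]"
    by (auto simp: numeral_2_eq_2 length_Suc_conv)
  then show False
    using assms by (cases e; cases f) (auto simp: awalk_simps)
qed

lemma graph_dist_eq_1:
  assumes "(u, v) \<in> parcs G" "u \<noteq> v"
  shows "graph_dist G u v = 1"
proof -
  have "awalk u [(u, v)] v"
    using assms by (auto simp: awalk_simps dest: wellformed')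
  moreover have "length [(u, v)] \<le> length q" if "awalk u q v" for q
    using that assms by (cases q) (auto simp: awalk_simps)
  ultimately show ?thesis
    using graph_dist_eqI by fastforce
qed

lemma graph_dist_eq_2:
  assumes "(u, w) \<in> parcs G" "(w, v) \<in> parcs G" "(u, v) \<notin> parcs G" "u \<noteq> v"
  shows "graph_dist G u v = 2"
proof -
  have "awalk u [(u, w), (w, v)] v"
    using assms by (auto simp: awalk_simps dest: wellformed')
  then show ?thesis
    using graph_dist_eqI[of u "[(u, w), (w, v)]" v] awalk_2_le_length[of u _ v] assms
    by (simp add: numeral_eq_Suc)
qed

lemma graph_dist_eq_3:
  assumes "(u, w) \<in> parcs G" "(w, x) \<in> parcs G" "(x, v) \<in> parcs G" "(u, v) \<notin> parcs G" "u \<noteq> v"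
    and "\<And>w. (u, w) \<in> parcs G \<Longrightarrow> (w, v) \<notin> parcs G"
  shows "graph_dist G u v = 3"
proof -
  have "awalk u [(u, w), (w, x), (x, v)] v"
    using assms by (auto simp: awalk_simps dest: wellformed')
  then show ?thesis
    using graph_dist_eqI[of u "[(u, w), (w, x), (x, v)]" v] awalk_3_le_length[of u _ v] assms
    by (simp add: numeral_eq_Suc)
qed

lemma shortest_paths_arc:
  assumes "(u, v) \<in> parcs G" "u \<noteq> v"
  shows "shortest_paths G u v = {[(u, v)]}"
proof -
  have dist: "ereal (real n) = 1 \<longleftrightarrow> n = 1" for n
    by simp
  have "apath u p v \<and> length p = 1 \<longleftrightarrow> p = [(u, v)]" for p
    using assms by (cases p) (auto simp: apath_simps dest: wellformed')
  then show ?thesis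
    unfolding shortest_paths_def graph_dist_eq_1[OF assms] dist by simp
qed

text \<open>A path with two arcs is determined by its middle vertex. The given \<open>w\<close> only
  certifies that the distance is 2; in the image, \<open>w\<close> is rebound and ranges over all
  common neighbours.\<close>

lemma shortest_paths_common_neighbour:
  assumes "(u, w) \<in> parcs G" "(w, v) \<in> parcs G" "(u, v) \<notin> parcs G" "u \<noteq> v"
  shows "shortest_paths G u v =
    (\<lambda>w. [(u, w), (w, v)]) ` {w. (u, w) \<in> parcs G \<and> (w, v) \<in> parcs G}"
proof -
  have dist: "ereal (real n) = 2 \<longleftrightarrow> n = 2" for n
    by (metis numeral_eq_ereal ereal.inject of_nat_eq_iff of_nat_numeral)
  have "apath u p v \<and> length p = 2 \<longleftrightarrow>
      p \<in> (\<lambda>w. [(u, w), (w, v)]) ` {w. (u, w) \<in> parcs G \<and> (w, v) \<in> parcs G}"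
    (is "?L \<longleftrightarrow> ?R") for p
  proof
    show "?L \<Longrightarrow> ?R"
      by (auto simp: numeral_2_eq_2 length_Suc_conv apath_simps)
    show "?R \<Longrightarrow> ?L"
      using assms by (auto simp: apath_simps dest: wellformed')
  qed
  then show ?thesis
    unfolding shortest_paths_def graph_dist_eq_2[OF assms] dist by simp
qed

lemma num_shortest_paths_arc:
  assumes "(u, v) \<in> parcs G" "u \<noteq> v"
  shows "num_shortest_paths G u v = 1"
  using shortest_paths_arc[OF assms] by (simp add: num_shortest_paths_def)

lemma num_shortest_paths_through_arc:
  assumes "(u, v) \<in> parcs G" "u \<noteq> v" "y \<noteq> u" "y \<noteq> v"
  shows "num_shortest_paths_through G y u v = 0"
  using shortest_paths_arc[OF assms(1,2)] assms(3,4)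
  by (auto simp: num_shortest_paths_through_def)

lemma num_shortest_paths_common_neighbour:
  assumes "(u, w) \<in> parcs G" "(w, v) \<in> parcs G" "(u, v) \<notin> parcs G" "u \<noteq> v"
  shows "num_shortest_paths G u v = card {w. (u, w) \<in> parcs G \<and> (w, v) \<in> parcs G}"
  unfolding num_shortest_paths_def shortest_paths_common_neighbour[OF assms]
  by (rule card_image) (auto simp: inj_on_def)

text \<open>As \<open>y\<close> is neither end, it can only be the middle vertex, which leaves at
  most one path.\<close>

lemma num_shortest_paths_through_common_neighbour:
  assumes "(u, w) \<in> parcs G" "(w, v) \<in> parcs G" "(u, v) \<notin> parcs G" "u \<noteq> v"
    and "y \<noteq> u" "y \<noteq> v"
  shows "num_shortest_paths_through G y u v =
    (if (u, y) \<in> parcs G \<and> (y, v) \<in> parcs G then 1 else 0)"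
proof -
  have "{p \<in> shortest_paths G u v. y \<in> set (pawalk_verts u p)} =
    (if (u, y) \<in> parcs G \<and> (y, v) \<in> parcs G then {[(u, y), (y, v)]} else {})"
    unfolding shortest_paths_common_neighbour[OF assms(1-4)] using assms(5,6) by auto
  then show ?thesis
    by (simp add: num_shortest_paths_through_def)
qed

end

section \<open>The cost of a player attached to a path on the other three\<close>

lemma pair_wf_digraph_strategy_graph: "pair_wf_digraph (strategy_graph n s)"
  by unfold_locales (auto simp: strategy_graph_def)

lemma strategy_graph_sym:
  "(i, j) \<in> parcs (strategy_graph n s) \<longleftrightarrow> (j, i) \<in> parcs (strategy_graph n s)"
  by (auto simp: strategy_graph_def)

text \<open>The base value is 3 * 2 = 6. Only \<open>(v, x)\<close> and \<open>(x, v)\<close> are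
  not joined by an arc, so only they can have a shortest path through \<open>u\<close>. If
  \<open>u\<close> is adjacent to both ends, it shares these pairs equally with \<open>w\<close>,
  and 1/2 + 1/2 is subtracted.\<close>

lemma betweenness_attached_to_path:
  assumes V: "{..<4} = {u, v, w, x}" and D: "distinct [u, v, w, x]"
    and E: "E = parcs (strategy_graph 4 s)"
    and path: "(v, w) \<in> E" "(w, x) \<in> E" "(v, x) \<notin> E"
  shows "betweenness 4 s u = (if (u, v) \<in> E \<and> (u, x) \<in> E then 5 else 6)"
proof -
  let ?G = "strategy_graph 4 s"
  let ?m = "num_shortest_paths ?G" and ?mu = "num_shortest_paths_through ?G u"
  interpret pair_wf_digraph ?G
    by (rule pair_wf_digraph_strategy_graph)
  have sym: "(i, j) \<in> E \<longleftrightarrow> (j, i) \<in> E" for i j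
    unfolding E by (rule strategy_graph_sym)
  have E_sub: "E \<subseteq> {u, v, w, x} \<times> {u, v, w, x}"
    unfolding E V[symmetric] by (auto simp: strategy_graph_def)
  have arc: "?m i j = 1" "?mu i j = 0" if "(i, j) \<in> {(v, w), (w, v), (w, x), (x, w)}" for i j
    using that path sym D unfolding E
    by (auto simp: num_shortest_paths_arc num_shortest_paths_through_arc)
  have ends: "?m i j = (if (u, v) \<in> E \<and> (u, x) \<in> E then 2 else 1)"
    "?mu i j = (if (u, v) \<in> E \<and> (u, x) \<in> E then 1 else 0)"
    if ij: "(i, j) \<in> {(v, x), (x, v)}" for i j
  proof -
    have h: "(i, w) \<in> E" "(w, j) \<in> E" "(i, j) \<notin> E" "i \<noteq> j" "u \<noteq> i" "u \<noteq> j"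
      using ij path sym D by auto
    have u: "(i, u) \<in> E \<and> (u, j) \<in> E \<longleftrightarrow> (u, v) \<in> E \<and> (u, x) \<in> E"
      using ij sym[of u v] sym[of u x] by auto
    \<comment> \<open>Neither \<open>i\<close> nor \<open>j\<close> can be the middle vertex, since
      \<open>(i, j)\<close> is not an arc.\<close>
    have "{y. (i, y) \<in> E \<and> (y, j) \<in> E} \<subseteq> {u, w}"
      using E_sub h ij by blast
    then have "{y. (i, y) \<in> E \<and> (y, j) \<in> E} =
        (if (u, v) \<in> E \<and> (u, x) \<in> E then {u, w} else {w})"
      using h(1,2) u by auto
    then show "?m i j = (if (u, v) \<in> E \<and> (u, x) \<in> E then 2 else 1)"
      using num_shortest_paths_common_neighbour[folded E, OF h(1-4)] D by simp
    show "?mu i j = (if (u, v) \<in> E \<and> (u, x) \<in> E then 1 else 0)"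
      using num_shortest_paths_through_common_neighbour[folded E, OF h] u by simp
  qed
  have lt: "i < 4 \<longleftrightarrow> i \<in> {u, v, w, x}" for i
    using V by blast
  \<comment> \<open>The path keeps \<open>v\<close>, \<open>w\<close>, \<open>x\<close> connected,
    so the positivity condition in the sum excludes none of the six ordered pairs.\<close>
  have "?m i j > 0" if "i \<in> {v, w, x}" "j \<in> {v, w, x}" "i \<noteq> j" for i j
    using that arc(1)[of i j] ends(1)[of i j] by (auto split: if_splits)
  then have "{(i, j). i < 4 \<and> j < 4 \<and> i \<noteq> j \<and> i \<noteq> u \<and> j \<noteq> u \<and> ?m i j > 0} =
      {(i, j). i \<in> {v, w, x} \<and> j \<in> {v, w, x} \<and> i \<noteq> j}"
    using lt D by auto
  also have "\<dots> = {(v, w), (w, v), (w, x), (x, w), (v, x), (x, v)}"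
    using D by auto
  finally show ?thesis
    unfolding betweenness_def
    using D arc[of v w] arc[of w v] arc[of w x] arc[of x w] ends[of v x] ends[of x v]
    by simp
qed

text \<open>One arc from \<open>u\<close> to the path makes all distances finite. The three summands
  multiplied by \<open>c\<close> are the distances to \<open>v\<close>, \<open>w\<close>,
  \<open>x\<close>, each reduced by 1.\<close>

lemma cost_attached_to_path:
  assumes V: "{..<4} = {u, v, w, x}" and D: "distinct [u, v, w, x]"
    and E: "E = parcs (strategy_graph 4 s)"
    and path: "(v, w) \<in> E" "(w, x) \<in> E" "(v, x) \<notin> E"
    and attached: "(u, v) \<in> E \<or> (u, w) \<in> E \<or> (u, x) \<in> E"
  shows "cost 4 b c s u = ereal (real (card (s u))
    + b * (if (u, v) \<in> E \<and> (u, x) \<in> E then 5 else 6)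
    + c * ((if (u, v) \<in> E then 0 else if (u, w) \<in> E then 1 else 2)
         + (if (u, w) \<in> E then 0 else 1)
         + (if (u, x) \<in> E then 0 else if (u, w) \<in> E then 1 else 2)))"
proof -
  let ?G = "strategy_graph 4 s"
  interpret pair_wf_digraph ?G
    by (rule pair_wf_digraph_strategy_graph)
  have sym: "(i, j) \<in> E \<longleftrightarrow> (j, i) \<in> E" for i j
    unfolding E by (rule strategy_graph_sym)
  have E_sub: "E \<subseteq> {u, v, w, x} \<times> {u, v, w, x}"
    unfolding E V[symmetric] by (auto simp: strategy_graph_def)
  note dists = graph_dist_eq_1[folded E] graph_dist_eq_2[folded E] graph_dist_eq_3[folded E]
  \<comment> \<open>Here \<open>y\<close> is the end to be reached and \<open>z\<close> the opposite
    one, which treats both ends at once.\<close>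
  have end_dist: "graph_dist ?G u y = ereal (if (u, y) \<in> E then 1 else if (u, w) \<in> E then 2 else 3)"
    if yz: "(y, z) = (v, x) \<or> (y, z) = (x, v)" for y z
  proof -
    have h: "(z, w) \<in> E" "(w, y) \<in> E" "(y, z) \<notin> E" "(z, y) \<notin> E" "u \<noteq> y"
      using yz path sym D by auto
    consider "(u, y) \<in> E" | "(u, y) \<notin> E" "(u, w) \<in> E"
      | "(u, y) \<notin> E" "(u, w) \<notin> E" "(u, z) \<in> E"
      using yz attached by blast
    then show ?thesis
    proof cases
      \<comment> \<open>The only neighbour of \<open>u\<close> is the far end \<open>z\<close>, so
        the whole path \<open>z\<close>, \<open>w\<close>, \<open>y\<close> has to be
        traversed.\<close>
      case 3
      have "(t, y) \<notin> E" if "(u, t) \<in> E" for t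
        using that E_sub 3 h sym yz by blast
      then show ?thesis
        using dists(3)[OF 3(3) h(1,2) 3(1) h(5)] 3 by simp
    qed (use h dists in auto)
  qed
  have "graph_dist ?G u w = ereal (if (u, w) \<in> E then 1 else 2)"
  proof (cases "(u, w) \<in> E")
    case False
    then obtain y where "(u, y) \<in> E" "(y, w) \<in> E"
      using attached path sym by blast
    then show ?thesis
      using False D dists(2)[of u y w] by simp
  qed (use D dists in auto)
  moreover have "{..<4} - {u} = {v, w, x}"
    using V D by auto
  ultimately have "closeness 4 s u = ereal
        ((if (u, v) \<in> E then 0 else if (u, w) \<in> E then 1 else 2)
         + (if (u, w) \<in> E then 0 else 1)
         + (if (u, x) \<in> E then 0 else if (u, w) \<in> E then 1 else 2))"
    using D end_dist[of v x] end_dist[of x v]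
    by (auto simp: closeness_def one_ereal_def)
  then show ?thesis
    using betweenness_attached_to_path[OF V D E path] by (simp add: cost_def)
qed

section \<open>The 4-cycle and unilateral deviations from it\<close>

definition cycle4_arcs :: "nat \<Rightarrow> nat \<Rightarrow> nat \<Rightarrow> nat \<Rightarrow> (nat \<times> nat) set" where
  "cycle4_arcs u v w x = {(u, v), (v, u), (v, w), (w, v), (w, x), (x, w), (x, u), (u, x)}"

lemma circle_graph_4E:
  assumes "circle_graph 4 G"
  obtains u v w x where "{..<4} = {u, v, w, x}" "distinct [u, v, w, x]"
    "G = \<lparr> pverts = {..<4}, parcs = cycle4_arcs u v w x \<rparr>"
proof -
  obtain p where p: "bij_betw p {..<4} {..<4}"
    and G: "G = \<lparr> pverts = {..<4},
              parcs = (\<Union>i<4. {(p i, p (Suc i mod 4)), (p (Suc i mod 4), p i)}) \<rparr>"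
    using assms unfolding circle_graph_def by auto
  have four: "{..<4::nat} = {0, 1, 2, 3}"
    by auto
  have UN_four: "(\<Union>i<4. f i) = f 0 \<union> f 1 \<union> f 2 \<union> f 3" for f :: "nat \<Rightarrow> (nat \<times> nat) set"
    unfolding four by (simp add: Un_assoc)
  have mods: "Suc 0 mod 4 = 1" "Suc 1 mod 4 = 2" "Suc 2 mod 4 = 3" "Suc 3 mod 4 = 0"
    by simp_all
  have "distinct (map p [0, 1, 2, 3])"
    using p four by (simp add: distinct_map bij_betw_def)
  moreover have "{..<4} = {p 0, p 1, p 2, p 3}"
    using p four by (simp add: bij_betw_def)
  moreover have "(\<Union>i<4. {(p i, p (Suc i mod 4)), (p (Suc i mod 4), p i)}) =
      cycle4_arcs (p 0) (p 1) (p 2) (p 3)"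
    by (simp only: UN_four cycle4_arcs_def mods Un_insert_left Un_empty_left)
  ultimately show thesis
    using that G by simp
qed

text \<open>Among \<open>v\<close>, \<open>w\<close>, \<open>x\<close>, the members of
  \<open>A\<close> are the neighbours of \<open>u\<close> after the deviation: channels opened
  towards \<open>u\<close> by others persist whatever \<open>t\<close> is. Arcs avoiding
  \<open>u\<close> do not change, so the path \<open>v\<close>, \<open>w\<close>, \<open>x\<close>
  remains.\<close>

lemma cost_deviation_from_cycle:
  assumes V: "{..<4} = {u, v, w, x}" and D: "distinct [u, v, w, x]"
    and cyc: "parcs (strategy_graph 4 s) = cycle4_arcs u v w x"
    and A: "A = t \<union> {y. u \<in> s y}" and attached: "v \<in> A \<or> w \<in> A \<or> x \<in> A"
  shows "cost 4 b c (s(u := t)) u = ereal (real (card t)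
    + b * (if v \<in> A \<and> x \<in> A then 5 else 6)
    + c * ((if v \<in> A then 0 else if w \<in> A then 1 else 2)
         + (if w \<in> A then 0 else 1)
         + (if x \<in> A then 0 else if w \<in> A then 1 else 2)))"
proof -
  let ?E = "parcs (strategy_graph 4 (s(u := t)))"
  have lt: "i < 4 \<longleftrightarrow> i \<in> {u, v, w, x}" for i
    using V by blast
  have old: "(i, j) \<in> ?E \<longleftrightarrow> (i, j) \<in> cycle4_arcs u v w x" if "i \<noteq> u" "j \<noteq> u" for i j
    using that unfolding cyc[symmetric] by (simp add: strategy_graph_def)
  have new: "(u, y) \<in> ?E \<longleftrightarrow> y \<in> A" if "y \<in> {v, w, x}" for y
    using that D unfolding A strategy_graph_def lt by auto
  have "(v, w) \<in> ?E" "(w, x) \<in> ?E" "(v, x) \<notin> ?E"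
    using old D by (auto simp: cycle4_arcs_def)
  moreover have "(u, v) \<in> ?E \<or> (u, w) \<in> ?E \<or> (u, x) \<in> ?E"
    using new attached by auto
  ultimately show ?thesis
    using cost_attached_to_path[OF V D refl, of "s(u := t)" b c] new by simp
qed

text \<open>The graph fixes the strategies only up to ownership: a cycle channel may be opened from
  either side or from both, the diagonal from neither.\<close>

lemma cycle_strategies:
  assumes V: "{..<4} = {u, v, w, x}" and D: "distinct [u, v, w, x]"
    and cyc: "parcs (strategy_graph 4 s) = cycle4_arcs u v w x"
  shows "v \<in> s u \<or> u \<in> s v" "x \<in> s u \<or> u \<in> s x" "w \<notin> s u" "u \<notin> s w"
proof -
  have "(i, j) \<in> cycle4_arcs u v w x \<longleftrightarrow> j \<in> s i \<or> i \<in> s j"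
    if "i \<in> {u, v, w, x}" "j \<in> {u, v, w, x}" for i j
    using that unfolding cyc[symmetric] V[symmetric] by (simp add: strategy_graph_def)
  from this[of u v] this[of u x] this[of u w]
  show "v \<in> s u \<or> u \<in> s v" "x \<in> s u \<or> u \<in> s x" "w \<notin> s u" "u \<notin> s w"
    using D by (auto simp: cycle4_arcs_def)
qed

text \<open>This is the trivial deviation \<open>t = s u\<close>, which leaves \<open>s\<close> as
  it is.\<close>

lemma cost_cycle:
  assumes V: "{..<4} = {u, v, w, x}" and D: "distinct [u, v, w, x]"
    and cyc: "parcs (strategy_graph 4 s) = cycle4_arcs u v w x"
  shows "cost 4 b c s u = ereal (real (card (s u)) + b * 5 + c)"
  using cost_deviation_from_cycle[OF V D cyc refl, of "s u" b c] cycle_strategies[OF V D cyc]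
  by simp

section \<open>Necessity: two deviations that must not pay off\<close>

lemma nash_cycle_closeness_le_1:
  assumes V: "{..<4} = {u, v, w, x}" and D: "distinct [u, v, w, x]"
    and cyc: "parcs (strategy_graph 4 s) = cycle4_arcs u v w x"
    and nash: "nash_equilibrium 4 b c s"
  shows "c \<le> 1"
proof -
  note S = cycle_strategies[OF V D cyc]
  have u: "u < 4" and w: "w \<in> {..<4} - {u}"
    using V D by auto
  with nash have sub: "s u \<subseteq> {..<4} - {u}"
    by (auto simp: nash_equilibrium_def strategy_combination_def)
  then have "finite (s u)"
    using finite_subset by blast
  then have "card (insert w (s u)) = card (s u) + 1"
    using S by simp
  \<comment> \<open>The diagonal costs one channel and shortens the distance to \<open>w\<close>
    from 2 to 1, saving \<open>c\<close>. Betweenness stays 5 because both cycle channels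
    remain.\<close>
  moreover have "\<not> cost 4 b c (s(u := insert w (s u))) u < cost 4 b c s u"
    using nash u sub w by (simp add: nash_equilibrium_def)
  ultimately show ?thesis
    using S D unfolding cost_cycle[OF V D cyc]
    by (subst (asm) cost_deviation_from_cycle[OF V D cyc refl]) auto
qed

lemma nash_cycle_le_betweenness_plus_closeness:
  assumes V: "{..<4} = {u, v, w, x}" and D: "distinct [u, v, w, x]"
    and cyc: "parcs (strategy_graph 4 s) = cycle4_arcs u v w x"
    and nash: "nash_equilibrium 4 b c s" and "v \<in> s u" and "b \<ge> 0" "c > 0"
  shows "1 \<le> b + 2 * c"
proof -
  note S = cycle_strategies[OF V D cyc]
  have u: "u < 4"
    using V by auto
  with nash have sub: "s u \<subseteq> {..<4} - {u}"
    by (auto simp: nash_equilibrium_def strategy_combination_def)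
  then have "finite (s u)"
    using finite_subset by blast
  then have card: "real (card (s u - {v})) = real (card (s u)) - 1"
    using \<open>v \<in> s u\<close> card_gt_0_iff[of "s u"] by (auto simp: of_nat_diff)
  \<comment> \<open>If \<open>v\<close> also owns the channel, dropping it saves 1 and leaves the
    graph unchanged, contradicting equilibrium. Otherwise \<open>u\<close> keeps only
    \<open>x\<close>, and the saved 1 is set against an increase of
    \<open>b + 2 * c\<close>.\<close>
  have "\<not> cost 4 b c (s(u := s u - {v})) u < cost 4 b c s u"
    using nash u sub unfolding nash_equilibrium_def by (meson Diff_subset order_trans)
  then show ?thesis
    using S D card \<open>b \<ge> 0\<close> \<open>c > 0\<close> unfolding cost_cycle[OF V D cyc]
    by (subst (asm) cost_deviation_from_cycle[OF V D cyc refl]) (auto split: if_splits)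
qed

section \<open>Sufficiency: the cyclically oriented strategy combination\<close>

lemma oriented_cycle_no_improvement:
  assumes V: "{..<4} = {u, v, w, x}" and D: "distinct [u, v, w, x]"
    and s: "s u = {v}" "s v = {w}" "s w = {x}" "s x = {u}"
    and t: "t \<subseteq> {..<4} - {u}"
    and bc: "b \<ge> 0" "c > 0" "c \<le> 1" "1 \<le> b + 2 * c"
  shows "\<not> cost 4 b c (s(u := t)) u < cost 4 b c s u"
proof -
  have lt: "i < 4 \<longleftrightarrow> i \<in> {u, v, w, x}" for i
    using V by blast
  have cyc: "parcs (strategy_graph 4 s) = cycle4_arcs u v w x"
    unfolding strategy_graph_def cycle4_arcs_def lt using D s by auto
  have "t \<subseteq> {v, w, x}"
    using t V by auto
  then have "t = (if v \<in> t then {v} else {}) \<union> (if w \<in> t then {w} else {}) \<union> (if x \<in> t then {x} else {})"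
    by auto
  then have "card t = (if v \<in> t then 1 else 0) + (if w \<in> t then 1 else 0) + (if x \<in> t then 1 else 0)"
    using D by (auto split: if_splits)
  \<comment> \<open>Since \<open>s x = {u}\<close>, the neighbour \<open>x\<close> is kept for free.
    Without \<open>v\<close> and \<open>w\<close> in \<open>t\<close> the cost is at least
    \<open>6 * b + 3 * c\<close>, with \<open>w\<close> alone of the two at least
    \<open>1 + 6 * b + c\<close>, and with both at least \<open>2 + 5 * b\<close>; the cycle costs
    \<open>1 + 5 * b + c\<close>.\<close>
  then show ?thesis
    unfolding cost_cycle[OF V D cyc] using s D bc
    by (subst cost_deviation_from_cycle[OF V D cyc refl]) auto
qed

theorem proposition3:
  fixes b c :: real and G :: "nat pair_pre_digraph"
  assumes "b \<ge> 0" and "c > 0" and "circle_graph 4 G"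
  shows "nash_equilibrium_graph 4 b c G \<longleftrightarrow> c \<le> 1 \<and> 1 \<le> b + 2 * c"
proof -
  obtain u v w x where V: "{..<4} = {u, v, w, x}" and D: "distinct [u, v, w, x]"
    and G: "G = \<lparr> pverts = {..<4}, parcs = cycle4_arcs u v w x \<rparr>"
    using circle_graph_4E[OF assms(3)] .
  show ?thesis
  proof
    assume "nash_equilibrium_graph 4 b c G"
    then obtain s where nash: "nash_equilibrium 4 b c s" and "G = strategy_graph 4 s"
      by (auto simp: nash_equilibrium_graph_def)
    with G have cyc: "parcs (strategy_graph 4 s) = cycle4_arcs u v w x"
      by (metis pair_pre_digraph.select_convs(2))
    \<comment> \<open>The reflection swapping \<open>u\<close> with \<open>v\<close> and
      \<open>w\<close> with \<open>x\<close> preserves the cycle, so whichever of \<open>u\<close>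
      and \<open>v\<close> owns their channel can play the deviating role.\<close>
    have V': "{..<4} = {v, u, x, w}" and D': "distinct [v, u, x, w]"
      and cyc': "parcs (strategy_graph 4 s) = cycle4_arcs v u x w"
      using V D cyc by (auto simp: cycle4_arcs_def)
    have "1 \<le> b + 2 * c"
      using cycle_strategies(1)[OF V D cyc]
        nash_cycle_le_betweenness_plus_closeness[OF V D cyc nash _ assms(1,2)]
        nash_cycle_le_betweenness_plus_closeness[OF V' D' cyc' nash _ assms(1,2)] by blast
    with nash_cycle_closeness_le_1[OF V D cyc nash] show "c \<le> 1 \<and> 1 \<le> b + 2 * c"
      by blast
  next
    assume bc: "c \<le> 1 \<and> 1 \<le> b + 2 * c"
    \<comment> \<open>Each player opens the channel to the successor on the cycle; the empty set is
      the value at numbers that are not players.\<close>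
    define s where "s = (\<lambda>_. {})(u := {v}, v := {w}, w := {x}, x := {u})"
    have s: "s u = {v}" "s v = {w}" "s w = {x}" "s x = {u}"
      using D by (auto simp: s_def)
    have lt: "i < 4 \<longleftrightarrow> i \<in> {u, v, w, x}" for i
      using V by blast
    \<comment> \<open>The orientation is invariant under rotation, so each player in turn can take
      the role of \<open>u\<close>.\<close>
    have rot: "{u, v, w, x} = {v, w, x, u}" "{u, v, w, x} = {w, x, u, v}" "{u, v, w, x} = {x, u, v, w}"
      by auto
    have "\<not> cost 4 b c (s(y := t)) y < cost 4 b c s y" if y: "y < 4" and t: "t \<subseteq> {..<4} - {y}" for y t
    proof -
      consider "y = u" | "y = v" | "y = w" | "y = x"
        using y lt by blast
      then show ?thesis
      proof cases
        case 1
        show ?thesis unfolding 1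
          by (rule oriented_cycle_no_improvement[OF V D s])
             (use t 1 assms bc in auto)
      next
        case 2
        show ?thesis unfolding 2
          by (rule oriented_cycle_no_improvement[OF V[unfolded rot(1)] _ s(2,3,4,1)])
             (use t 2 D assms bc in auto)
      next
        case 3
        show ?thesis unfolding 3
          by (rule oriented_cycle_no_improvement[OF V[unfolded rot(2)] _ s(3,4,1,2)])
             (use t 3 D assms bc in auto)
      next
        case 4
        show ?thesis unfolding 4
          by (rule oriented_cycle_no_improvement[OF V[unfolded rot(3)] _ s(4,1,2,3)])
             (use t 4 D assms bc in auto)
      qed
    qed
    moreover have "strategy_combination 4 s"
      unfolding strategy_combination_def lt V using D s by auto
    moreover have "G = strategy_graph 4 s"
      unfolding G strategy_graph_def lt cycle4_arcs_def using D s by auto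
    ultimately show "nash_equilibrium_graph 4 b c G"
      unfolding nash_equilibrium_graph_def nash_equilibrium_def by blast
  qed
qed

end
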